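(* Let $P$ be any poset and let $p$ be a pattern over $P$. Then there are nondeterministic finite automata accepting $\mathcal{F}(p)$, $\mathcal{S}(p)$, and $\mathcal{A}(p)$.
   Context: $P^*$ is the free monoid of finite words over $P$. Generalized factor order: $u\le w$ iff there is a factor $w'$ of $w$ (consecutive letters) with $|w'|=|u|$ and $u_i\le w'_i$ for all $i$. A pattern over $P$ is a word in $P^*$ in which certain pairs of adjacent letters are overlined; it factors uniquely as $p=\overline{y_1}\,\overline{y_2}\cdots\overline{y_k}$ where $y_i\in P^*$ and $\overline{y_i}$ means all adjacent pairs within $y_i$ are overlined (and the pairs between consecutive $y_i$ are not). $p$ embeds into $w\in P^*$, written $p\to w$, if there is a subword $z_1z_2\cdots z_k$ of $w$ (the $z_i$ occurring in order, not necessarily contiguous with each other) such that each $z_i$ is a factor of $w$ with $|z_i|=|y_i|$ and $y_i\le z_i$ in generalized factor order. $\mathcal{F}(p)=\{w:p\to w\}$, $\mathcal{A}(p)=P^*-\mathcal{F}(p)$, and $\mathcal{S}(p)$ is defined analogously to $\mathcal{S}(u)$ (the words in $\mathcal{F}(p)$ in which the pattern can only be embedded with its last factor ending at the end of $w$). A nondeterministic finite automaton over $P$ is a directed graph with finitely many states, an initial state, a set of final states, and arcs labeled by elements of $P$; it accepts the words spelled by paths from the initial state to a final state. *)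

theory Defs
  imports "HOL-Library.Sublist"
begin

definition gen_factor_le :: "'a::order list \<Rightarrow> 'a list \<Rightarrow> bool"  (infix "\<le>\<^sub>g" 50) where
  "u \<le>\<^sub>g w \<longleftrightarrow> (\<exists>w'. sublist w' w \<and> length w' = length u \<and> (\<forall>i<length u. u ! i \<le> w' ! i))"

text \<open>A pattern is a word together with the set of those positions \<open>i\<close> (counted from 0) for which
  the adjacent pair formed by the letters at \<open>i\<close> and \<open>Suc i\<close> is overlined.\<close>

datatype 'a pattern = Pattern (letters: "'a list") (overlined: "nat set")

definition wf_pattern :: "'a pattern \<Rightarrow> bool" where
  "wf_pattern p \<longleftrightarrow> (\<forall>i \<in> overlined p. Suc i < length (letters p))"

text \<open>The non-overlined pairs are exactly those straddling the border between two consecutive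
  factors; the first \<open>j\<close> factors together have length \<open>length (concat (take j ys))\<close>.\<close>

definition factors_as :: "'a pattern \<Rightarrow> 'a list list \<Rightarrow> bool" where
  "factors_as p ys \<longleftrightarrow> concat ys = letters p \<and> [] \<notin> set ys \<and>
    (\<forall>i. Suc i < length (letters p) \<longrightarrow>
      (i \<notin> overlined p \<longleftrightarrow> (\<exists>j. Suc i = length (concat (take j ys)))))"

definition factorization :: "'a pattern \<Rightarrow> 'a list list" where
  "factorization p = (THE ys. factors_as p ys)"

text \<open>An embedding is recorded by the list \<open>ns\<close> of starting positions in \<open>w\<close> of
  \<open>z\<^sub>1, \<dots>, z\<^sub>k\<close>; the last condition says that the \<open>z\<^sub>i\<close> occur in order without overlapping.\<close>

definition embedding :: "'a::order pattern \<Rightarrow> 'a list \<Rightarrow> nat list \<Rightarrow> bool" where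
  "embedding p w ns \<longleftrightarrow>
    (let ys = factorization p in
      length ns = length ys \<and>
      (\<forall>j<length ys. \<exists>x z x'. w = x @ z @ x' \<and> length x = ns ! j \<and>
         length z = length (ys ! j) \<and> ys ! j \<le>\<^sub>g z) \<and>
      (\<forall>j. Suc j < length ys \<longrightarrow> ns ! j + length (ys ! j) \<le> ns ! Suc j))"

definition embeds :: "'a::order pattern \<Rightarrow> 'a list \<Rightarrow> bool" where
  "embeds p w \<longleftrightarrow> (\<exists>ns. embedding p w ns)"

text \<open>The empty pattern has no last factor. Its embedding is taken to end at position 0, so that
  its suffix language is \<open>{[]}\<close>, which is also the suffix language of the empty word.\<close>

definition embedding_end :: "'a pattern \<Rightarrow> nat list \<Rightarrow> nat" where
  "embedding_end p ns = (if ns = [] then 0 else last ns + length (last (factorization p)))"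

definition pattern_F :: "'a::order pattern \<Rightarrow> 'a list set" where
  "pattern_F p = {w. embeds p w}"

definition pattern_S :: "'a::order pattern \<Rightarrow> 'a list set" where
  "pattern_S p = {w \<in> pattern_F p. \<forall>ns. embedding p w ns \<longrightarrow> embedding_end p ns = length w}"

definition pattern_A :: "'a::order pattern \<Rightarrow> 'a list set" where
  "pattern_A p = UNIV - pattern_F p"

text \<open>Only the set of states has to be finite: an infinite alphabet may give rise to infinitely
  many arcs.\<close>

record ('s, 'a) nfa =
  states :: "'s set"
  initial :: 's
  finals :: "'s set"
  arcs :: "('s \<times> 'a \<times> 's) set"

definition is_nfa :: "('s, 'a) nfa \<Rightarrow> bool" where
  "is_nfa M \<longleftrightarrow> finite (states M) \<and> initial M \<in> states M \<and> finals M \<subseteq> states M \<and>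
    arcs M \<subseteq> states M \<times> UNIV \<times> states M"

inductive nfa_path :: "('s, 'a) nfa \<Rightarrow> 's \<Rightarrow> 'a list \<Rightarrow> 's \<Rightarrow> bool" for M where
  empty: "q \<in> states M \<Longrightarrow> nfa_path M q [] q"
| step: "(q, a, q') \<in> arcs M \<Longrightarrow> nfa_path M q' w q'' \<Longrightarrow> nfa_path M q (a # w) q''"

definition accepted :: "('s, 'a) nfa \<Rightarrow> 'a list set" where
  "accepted M = {w. \<exists>q \<in> finals M. nfa_path M (initial M) w q}"

text \<open>Taking natural numbers as states loses no generality, since there are only finitely many.\<close>

definition nfa_recognizable :: "'a list set \<Rightarrow> bool" where
  "nfa_recognizable L \<longleftrightarrow> (\<exists>M :: (nat, 'a) nfa. is_nfa M \<and> accepted M = L)"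

text \<open>Every pattern has a unique factorization, so \<^const>\<open>factorization\<close> is well defined.\<close>

lemma ex_cut_Cons:
  "(\<exists>j. n = length (concat (take j (y # ys)))) \<longleftrightarrow>
     n = 0 \<or> (\<exists>j. n = length y + length (concat (take j ys)))"
proof
  assume "\<exists>j. n = length (concat (take j (y # ys)))"
  then obtain j where "n = length (concat (take j (y # ys)))" ..
  then show "n = 0 \<or> (\<exists>j. n = length y + length (concat (take j ys)))"
    by (cases j) auto
next
  assume "n = 0 \<or> (\<exists>j. n = length y + length (concat (take j ys)))"
  then show "\<exists>j. n = length (concat (take j (y # ys)))"
  proof
    assume "n = 0"
    then show ?thesis by (intro exI[of _ 0]) simp
  next
    assume "\<exists>j. n = length y + length (concat (take j ys))"
    then obtain j where "n = length y + length (concat (take j ys))" ..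
    then show ?thesis by (intro exI[of _ "Suc j"]) simp
  qed
qed

lemma all_less_Suc_split:
  "(\<forall>i. Suc i < Suc (Suc n) \<longrightarrow> P i) \<longleftrightarrow> P 0 \<and> (\<forall>i. Suc i < Suc n \<longrightarrow> P (Suc i))"
  by (metis Suc_less_eq not0_implies_Suc zero_less_Suc)

lemma factors_as_Nil: "factors_as (Pattern [] S) ys \<longleftrightarrow> ys = []"
  by (cases ys) (auto simp: factors_as_def)

lemma factors_as_single: "factors_as (Pattern [a] S) ys \<longleftrightarrow> ys = [[a]]"
proof
  assume "factors_as (Pattern [a] S) ys"
  then have "concat ys = [a]" "[] \<notin> set ys"
    by (auto simp: factors_as_def)
  then show "ys = [[a]]"
    by (cases ys; cases "hd ys"; cases "tl ys") (auto simp: append_eq_Cons_conv)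
qed (auto simp: factors_as_def)

lemma factors_as_new_block:
  "factors_as (Pattern (a # b # u) S) ([a] # ys) \<longleftrightarrow>
     0 \<notin> S \<and> factors_as (Pattern (b # u) {i. Suc i \<in> S}) ys"
proof -
  have "\<exists>j. 0 = length (concat (take j ys))"
    by (intro exI[of _ 0]) simp
  then show ?thesis
    unfolding factors_as_def pattern.sel ex_cut_Cons
    by (auto simp: all_less_Suc_split less_Suc_eq_0_disj simp del: length_concat)
qed

lemma factors_as_same_block:
  assumes "y \<noteq> []"
  shows "factors_as (Pattern (a # b # u) S) ((a # y) # ys) \<longleftrightarrow>
     0 \<in> S \<and> factors_as (Pattern (b # u) {i. Suc i \<in> S}) (y # ys)"
  using assms unfolding factors_as_def pattern.sel ex_cut_Cons
  by (auto simp: all_less_Suc_split less_Suc_eq_0_disj simp del: length_concat)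

lemma ex1_factors_as: "\<exists>!ys. factors_as p ys"
proof (cases p)
  case (Pattern u S)
  have "\<exists>!ys. factors_as (Pattern u S) ys"
  proof (induction u arbitrary: S rule: induct_list012)
    case 1
    show ?case by (simp add: factors_as_Nil)
  next
    case (2 a)
    show ?case by (simp add: factors_as_single)
  next
    case (3 a b u)
    let ?q = "Pattern (b # u) {i. Suc i \<in> S}"
    obtain ys where ys: "factors_as ?q ys" and uniq: "\<And>zs. factors_as ?q zs \<Longrightarrow> zs = ys"
      using 3(2) by blast
    obtain y ys' where ys': "ys = y # ys'" "y \<noteq> []"
      using ys by (cases ys) (auto simp: factors_as_def)
    have shape: "(\<exists>vs. zs = [a] # vs) \<or> (\<exists>v vs. zs = (a # v) # vs \<and> v \<noteq> [])"
      if "factors_as (Pattern (a # b # u) S) zs" for zs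
      using that by (cases zs; cases "hd zs") (auto simp: factors_as_def)
    show ?case
    proof (cases "0 \<in> S")
      case True
      show ?thesis
      proof (rule ex1I[of _ "(a # y) # ys'"])
        show "factors_as (Pattern (a # b # u) S) ((a # y) # ys')"
          using True ys ys' by (simp add: factors_as_same_block)
        show "zs = (a # y) # ys'" if "factors_as (Pattern (a # b # u) S) zs" for zs
          using shape[OF that] that True ys' uniq
          by (fastforce simp: factors_as_same_block factors_as_new_block)
      qed
    next
      case False
      show ?thesis
      proof (rule ex1I[of _ "[a] # ys"])
        show "factors_as (Pattern (a # b # u) S) ([a] # ys)"
          using False ys by (simp add: factors_as_new_block)
        show "zs = [a] # ys" if "factors_as (Pattern (a # b # u) S) zs" for zs
          using shape[OF that] that False uniq
          by (auto simp: factors_as_same_block factors_as_new_block)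
      qed
    qed
  qed
  then show ?thesis using Pattern by simp
qed

lemma factors_as_factorization: "factors_as p (factorization p)"
  unfolding factorization_def by (rule theI'[OF ex1_factors_as])

end

theory Submission
  imports Defs
begin

text \<open>By the Myhill--Nerode argument, a language with finitely many residuals is recognized by the
  automaton whose states are these residuals, and the class of such languages is closed under
  complement, intersection and concatenation. Write \<open>E\<close> for the concatenation of
  \<open>P\<^sup>*Y\<^sub>1, \<dots>, P\<^sup>*Y\<^sub>k\<close>, where \<open>Y\<^sub>i\<close> is the set of words of length \<open>|y\<^sub>i|\<close> above \<open>y\<^sub>i\<close>. The words in
  \<open>E\<close> are those with an embedding ending at their last letter, so that
  \<open>\<F>(p) = E P\<^sup>*\<close> and \<open>\<S>(p) = \<F>(p) - E P\<^sup>+\<close>.\<close>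

section \<open>Languages with finitely many residuals\<close>

text \<open>The left quotient of \<open>L\<close> by \<open>w\<close>, also known as its Brzozowski
  derivative.\<close>

definition residual :: "'a list \<Rightarrow> 'a list set \<Rightarrow> 'a list set" where
  "residual w L = {v. w @ v \<in> L}"

definition finite_residuals :: "'a list set \<Rightarrow> bool" where
  "finite_residuals L \<longleftrightarrow> finite (range (\<lambda>w. residual w L))"

definition conc :: "'a list set \<Rightarrow> 'a list set \<Rightarrow> 'a list set" where
  "conc L K = {u @ v | u v. u \<in> L \<and> v \<in> K}"

lemma residual_Nil [simp]: "residual [] L = L"
  by (simp add: residual_def)

lemma residual_append: "residual (u @ v) L = residual v (residual u L)"
  by (simp add: residual_def)

lemma residual_Cons: "residual (a # w) L = residual w (residual [a] L)"
  using residual_append[of "[a]" w L] by simp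

lemma nfa_recognizable_if_finite_residuals:
  assumes "finite_residuals L"
  shows "nfa_recognizable L"
proof -
  define R where "R = range (\<lambda>w. residual w L)"
  have "finite R"
    using assms by (simp add: R_def finite_residuals_def)
  \<comment> \<open>The states must be natural numbers, so residuals are coded by an injection
    \<open>h\<close>.\<close>
  then obtain h :: "'a list set \<Rightarrow> nat" where inj: "inj_on h R"
    using finite_imp_inj_to_nat_seg by blast
  have step: "residual w X \<in> R" if "X \<in> R" for X w
    using that by (auto simp: R_def simp flip: residual_append)
  have L: "L \<in> R"
    unfolding R_def by (metis rangeI residual_Nil)
  define M where "M = \<lparr>states = h ` R, initial = h L, finals = h ` {X \<in> R. [] \<in> X},
    arcs = {(h X, a, h (residual [a] X)) | X a. X \<in> R}\<rparr>"
  \<comment> \<open>The automaton is deterministic and complete: exactly one state is reached on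
    each word. Arbitrary \<open>X\<close> in \<open>R\<close> is needed because the first letter
    changes the residual.\<close>
  have path: "nfa_path M (h X) w q \<longleftrightarrow> q = h (residual w X)" if "X \<in> R" for X w q
    using that
  proof (induction w arbitrary: X)
    case Nil
    then show ?case
      by (auto simp: M_def elim: nfa_path.cases intro: nfa_path.intros)
  next
    case (Cons a w)
    have "nfa_path M (h X) (a # w) q \<longleftrightarrow> nfa_path M (h (residual [a] X)) w q"
    proof
      assume "nfa_path M (h X) (a # w) q"
      then obtain q' where "(h X, a, q') \<in> arcs M" "nfa_path M q' w q"
        by (cases rule: nfa_path.cases) auto
      \<comment> \<open>Injectivity on \<open>R\<close> excludes an arc that leaves
        \<open>h X\<close> on behalf of a different residual.\<close>
      then show "nfa_path M (h (residual [a] X)) w q"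
        using inj Cons.prems by (auto simp: M_def dest: inj_onD)
    next
      assume "nfa_path M (h (residual [a] X)) w q"
      then show "nfa_path M (h X) (a # w) q"
        using Cons.prems by (auto simp: M_def intro!: nfa_path.step)
    qed
    then show ?case
      using Cons.IH[OF step[OF Cons.prems]] by (simp add: residual_Cons[of a w])
  qed
  have "is_nfa M"
    using \<open>finite R\<close> L step by (auto simp: M_def is_nfa_def)
  moreover have "accepted M = L"
  proof (rule set_eqI)
    fix w
    have "w \<in> accepted M \<longleftrightarrow> h (residual w L) \<in> h ` {X \<in> R. [] \<in> X}"
      using path[OF L] by (auto simp: accepted_def M_def)
    also have "\<dots> \<longleftrightarrow> [] \<in> residual w L"
      using inj step[OF L] by (auto dest: inj_onD)
    finally show "w \<in> accepted M \<longleftrightarrow> w \<in> L"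
      by (simp add: residual_def)
  qed
  ultimately show ?thesis
    unfolding nfa_recognizable_def by blast
qed

section \<open>Closure properties of languages with finitely many residuals\<close>

lemma finite_residuals_UNIV: "finite_residuals UNIV"
  by (simp add: finite_residuals_def residual_def)

lemma finite_residuals_Compl:
  assumes "finite_residuals L"
  shows "finite_residuals (- L)"
proof -
  have "residual w (- L) = - residual w L" for w
    by (auto simp: residual_def)
  then have "range (\<lambda>w. residual w (- L)) = uminus ` range (\<lambda>w. residual w L)"
    by auto
  then show ?thesis
    using assms by (simp add: finite_residuals_def)
qed

lemma finite_residuals_Int:
  assumes "finite_residuals L" and "finite_residuals K"
  shows "finite_residuals (L \<inter> K)"
proof -
  let ?Q = "range (\<lambda>w. residual w L) \<times> range (\<lambda>w. residual w K)"
  have "residual w (L \<inter> K) = residual w L \<inter> residual w K" for w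
    by (auto simp: residual_def)
  then have "range (\<lambda>w. residual w (L \<inter> K)) \<subseteq> (\<lambda>(X, Y). X \<inter> Y) ` ?Q"
    by auto
  then show ?thesis
    using assms unfolding finite_residuals_def by (meson finite_SigmaI finite_imageI finite_subset)
qed

text \<open>In a split of \<open>w @ t\<close> into a word of \<open>L\<close> and a word of
  \<open>K\<close>, the cut lies either inside \<open>t\<close>, which gives the first term, or
  inside \<open>w\<close>, where the rest of \<open>w\<close> has already been read by
  \<open>K\<close>.\<close>

lemma residual_conc:
  "residual w (conc L K) =
    conc (residual w L) K \<union> \<Union> {residual v K | u v. w = u @ v \<and> u \<in> L}"
proof (intro set_eqI iffI)
  fix t
  assume "t \<in> residual w (conc L K)"
  then obtain u v where "w @ t = u @ v" and uv: "u \<in> L" "v \<in> K"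
    by (auto simp: residual_def conc_def)
  then consider c where "w = u @ c" "v = c @ t" | c where "u = w @ c" "t = c @ v"
    by (auto simp: append_eq_append_conv2)
  then show "t \<in> conc (residual w L) K \<union> \<Union> {residual v K | u v. w = u @ v \<and> u \<in> L}"
  proof cases
    case 1
    then have "t \<in> residual c K"
      using uv by (simp add: residual_def)
    then show ?thesis
      using 1 uv by blast
  next
    case 2
    then have "c \<in> residual w L"
      using uv by (simp add: residual_def)
    then show ?thesis
      using 2 uv by (auto simp: conc_def)
  qed
next
  fix t
  assume "t \<in> conc (residual w L) K \<union> \<Union> {residual v K | u v. w = u @ v \<and> u \<in> L}"
  then consider c v where "t = c @ v" "w @ c \<in> L" "v \<in> K"
    | u v where "w = u @ v" "u \<in> L" "v @ t \<in> K"
    by (auto simp: residual_def conc_def)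
  then have "\<exists>u v. w @ t = u @ v \<and> u \<in> L \<and> v \<in> K"
    by cases (metis append.assoc)+
  then show "t \<in> residual w (conc L K)"
    by (simp add: residual_def conc_def)
qed

lemma finite_residuals_conc:
  assumes "finite_residuals L" and "finite_residuals K"
  shows "finite_residuals (conc L K)"
proof -
  \<comment> \<open>As in the subset construction, a residual of the product is determined by one
    residual of \<open>L\<close> and a set of residuals of \<open>K\<close>, and a finite set has
    finitely many subsets.\<close>
  let ?Q = "range (\<lambda>w. residual w L) \<times> Pow (range (\<lambda>w. residual w K))"
  have "residual w (conc L K) \<in> (\<lambda>(X, \<Y>). conc X K \<union> \<Union> \<Y>) ` ?Q" for w
    unfolding residual_conc
    by (rule image_eqI[of _ _ "(residual w L, {residual v K | u v. w = u @ v \<and> u \<in> L})"]) auto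
  then have "range (\<lambda>w. residual w (conc L K)) \<subseteq> (\<lambda>(X, \<Y>). conc X K \<union> \<Union> \<Y>) ` ?Q"
    by blast
  moreover have "finite ?Q"
    using assms by (simp add: finite_residuals_def)
  ultimately show ?thesis
    unfolding finite_residuals_def by (meson finite_imageI finite_subset)
qed

text \<open>The alphabet, and hence this language, may be infinite. A letter nevertheless matters
  only through whether it is related to the head of \<open>y\<close>: if so, the tail of
  \<open>y\<close> remains to be matched, otherwise nothing can follow.\<close>

lemma finite_residuals_list_all2: "finite_residuals {z. list_all2 R y z}"
proof (induction y)
  case Nil
  have "range (\<lambda>w. residual w {z. list_all2 R [] z}) \<subseteq> {{[]}, {}}"
    by (auto simp: residual_def)
  then show ?case
    unfolding finite_residuals_def by (rule finite_subset) simp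
next
  case (Cons b y)
  let ?Y = "{z. list_all2 R y z}"
  have "residual w {z. list_all2 R (b # y) z} \<in>
      insert {z. list_all2 R (b # y) z} (insert {} (range (\<lambda>w. residual w ?Y)))" for w
  proof (cases w)
    case (Cons a v)
    then have "residual w {z. list_all2 R (b # y) z} = (if R b a then residual v ?Y else {})"
      by (auto simp: residual_def)
    then show ?thesis by simp
  qed simp
  then have "range (\<lambda>w. residual w {z. list_all2 R (b # y) z}) \<subseteq>
      insert {z. list_all2 R (b # y) z} (insert {} (range (\<lambda>w. residual w ?Y)))"
    by blast
  then show ?case
    using Cons.IH unfolding finite_residuals_def by (meson finite_insert finite_subset)
qed

section \<open>Embeddings of patterns\<close>

text \<open>The language \<open>E\<close> of the idea above. Each \<open>UNIV\<close> is the gap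
  before a factor; the base case \<open>{[]}\<close> agrees with the convention that the empty
  pattern ends at position 0.\<close>

fun ends_lang :: "'a::order list list \<Rightarrow> 'a list set" where
  "ends_lang [] = {[]}"
| "ends_lang (y # ys) = conc UNIV (conc {z. list_all2 (\<le>) y z} (ends_lang ys))"

lemma finite_residuals_singleton_Nil: "finite_residuals {[]}"
  using finite_residuals_list_all2[of _ "[]"] by simp

lemma finite_residuals_ends_lang: "finite_residuals (ends_lang ys)"
  by (induction ys) (simp_all add: finite_residuals_singleton_Nil finite_residuals_conc
      finite_residuals_UNIV finite_residuals_list_all2)

text \<open>The only factor of \<open>z\<close> that has the length of \<open>z\<close> is
  \<open>z\<close> itself.\<close>

lemma gen_factor_le_same_length:
  assumes "length z = length y"
  shows "y \<le>\<^sub>g z \<longleftrightarrow> list_all2 (\<le>) y z"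
proof -
  have "w' = z" if "sublist w' z" "length w' = length y" for w'
    using that assms by (auto simp: sublist_def)
  then show ?thesis
    using assms unfolding gen_factor_le_def list_all2_conv_all_nth by (metis sublist_order.order_refl)
qed

text \<open>Taking the factors as an argument, instead of reading them off a pattern, permits
  induction on their list.\<close>

definition factors_embedding :: "'a::order list list \<Rightarrow> 'a list \<Rightarrow> nat list \<Rightarrow> bool" where
  "factors_embedding ys w ns \<longleftrightarrow> length ns = length ys \<and>
    (\<forall>j<length ys. \<exists>x z x'. w = x @ z @ x' \<and> length x = ns ! j \<and> list_all2 (\<le>) (ys ! j) z) \<and>
    (\<forall>j. Suc j < length ys \<longrightarrow> ns ! j + length (ys ! j) \<le> ns ! Suc j)"

text \<open>The default \<open>c\<close> is the end of what precedes the factors \<open>ys\<close> when these are the tail of a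
  longer list.\<close>

definition factors_end :: "nat \<Rightarrow> 'a list list \<Rightarrow> nat list \<Rightarrow> nat" where
  "factors_end c ys ns = (if ns = [] then c else last ns + length (last ys))"

lemma embedding_conv: "embedding p w ns \<longleftrightarrow> factors_embedding (factorization p) w ns"
proof -
  have "length z = length y \<and> y \<le>\<^sub>g z \<longleftrightarrow> list_all2 (\<le>) y z" for y z :: "'a list"
    using gen_factor_le_same_length[of z y] list_all2_lengthD[of "(\<le>)" y z] by auto
  then show ?thesis
    by (simp add: embedding_def factors_embedding_def Let_def)
qed

lemma embedding_end_conv: "embedding_end p ns = factors_end 0 (factorization p) ns"
  by (simp add: embedding_end_def factors_end_def)

lemma factors_embedding_Nil: "factors_embedding [] w ns \<longleftrightarrow> ns = []"
  by (simp add: factors_embedding_def)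

lemma factors_embedding_Cons:
  "factors_embedding (y # ys) w ns \<longleftrightarrow> (\<exists>n ns'. ns = n # ns' \<and>
    (\<exists>x z x'. w = x @ z @ x' \<and> length x = n \<and> list_all2 (\<le>) y z) \<and>
    factors_embedding ys w ns' \<and> (ns' \<noteq> [] \<longrightarrow> n + length y \<le> hd ns'))"
proof (cases ns)
  case Nil
  then show ?thesis by (simp add: factors_embedding_def)
next
  case (Cons n ns')
  have hd_iff: "(0 < length ys \<longrightarrow> n + length y \<le> ns' ! 0) \<longleftrightarrow> (ns' \<noteq> [] \<longrightarrow> n + length y \<le> hd ns')"
    if "length ns' = length ys"
    using that by (auto simp: hd_conv_nth)
  have split: "(\<forall>j. Suc j < Suc k \<longrightarrow> Q j) \<longleftrightarrow> (0 < k \<longrightarrow> Q 0) \<and> (\<forall>j. Suc j < k \<longrightarrow> Q (Suc j))"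
    for k and Q :: "nat \<Rightarrow> bool"
    by (cases k) (simp_all add: All_less_Suc2)
  have "factors_embedding (y # ys) w (n # ns') \<longleftrightarrow>
      (\<exists>x z x'. w = x @ z @ x' \<and> length x = n \<and> list_all2 (\<le>) y z) \<and>
      factors_embedding ys w ns' \<and> (ns' \<noteq> [] \<longrightarrow> n + length y \<le> hd ns')"
  proof (cases "length ns' = length ys")
    case True
    show ?thesis
      unfolding factors_embedding_def hd_iff[OF True, symmetric] list.size add_Suc_right
        add_0_right split All_less_Suc2 nth_Cons_0 nth_Cons_Suc
      by (simp only: True conj_ac simp_thms)
  qed (simp add: factors_embedding_def)
  then show ?thesis
    unfolding Cons list.inject by blast
qed

text \<open>The end of the first factor becomes the default for the tail, which takes effect when
  that factor is also the last.\<close>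

lemma factors_end_Cons:
  assumes "length ns = length ys"
  shows "factors_end c (y # ys) (n # ns) = factors_end (n + length y) ys ns"
  using assms by (auto simp: factors_end_def)

text \<open>Positions count from the start of the whole word, so the induction moves the factors
  already placed into the prefix \<open>s\<close> and never shifts \<open>ns\<close>.\<close>

lemma ends_lang_if_factors_embedding:
  assumes "factors_embedding ys (s @ t) ns" and "ns \<noteq> [] \<Longrightarrow> length s \<le> hd ns"
  shows "\<exists>u v. t = u @ v \<and> u \<in> ends_lang ys \<and> factors_end (length s) ys ns = length s + length u"
  using assms
proof (induction ys arbitrary: s t ns)
  case Nil
  then show ?case by (simp add: factors_embedding_Nil factors_end_def)
next
  case (Cons y ys)
  from Cons.prems obtain x z x' ns' where ns: "ns = length x # ns'"
    and st: "s @ t = x @ z @ x'" and z: "list_all2 (\<le>) y z"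
    and emb: "factors_embedding ys (s @ t) ns'"
    and hd: "ns' \<noteq> [] \<Longrightarrow> length x + length y \<le> hd ns'"
    unfolding factors_embedding_Cons by blast
  have len: "length z = length y"
    using z by (simp add: list_all2_lengthD)
  have "length s \<le> length x"
    using Cons.prems(2) ns by simp
  then obtain x0 where x: "x = s @ x0" and t: "t = x0 @ z @ x'"
    using st by (auto simp: append_eq_append_conv2)
  \<comment> \<open>The new prefix \<open>x @ z\<close> stops where the first factor ends, and the
    non-overlap condition puts all later starts at or beyond that point.\<close>
  obtain u v where "x' = u @ v" "u \<in> ends_lang ys"
    "factors_end (length (x @ z)) ys ns' = length (x @ z) + length u"
    using Cons.IH[of "x @ z" x' ns'] emb hd st len by auto
  moreover have "length ns' = length ys"
    using emb by (simp add: factors_embedding_def)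
  ultimately have "t = (x0 @ z @ u) @ v" "x0 @ z @ u \<in> ends_lang (y # ys)"
    "factors_end (length s) (y # ys) ns = length s + length (x0 @ z @ u)"
    using t x z ns len by (auto simp: factors_end_Cons conc_def add.assoc)
  then show ?case by blast
qed

lemma factors_embedding_if_ends_lang:
  assumes "u \<in> ends_lang ys"
  shows "\<exists>ns. factors_embedding ys (s @ u @ v) ns \<and> (ns \<noteq> [] \<longrightarrow> length s \<le> hd ns) \<and>
    factors_end (length s) ys ns = length s + length u"
  using assms
proof (induction ys arbitrary: s u)
  case Nil
  then show ?case by (simp add: factors_embedding_Nil factors_end_def)
next
  case (Cons y ys)
  then obtain x z u' where u: "u = x @ z @ u'" and z: "list_all2 (\<le>) y z"
    and u': "u' \<in> ends_lang ys"
    by (auto simp: conc_def)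
  have len: "length z = length y"
    using z by (simp add: list_all2_lengthD)
  obtain ns where ns: "factors_embedding ys ((s @ x @ z) @ u' @ v) ns"
    "ns \<noteq> [] \<longrightarrow> length (s @ x @ z) \<le> hd ns"
    "factors_end (length (s @ x @ z)) ys ns = length (s @ x @ z) + length u'"
    using Cons.IH[OF u'] by blast
  have "\<exists>x1 z1 x1'. s @ u @ v = x1 @ z1 @ x1' \<and> length x1 = length s + length x \<and>
      list_all2 (\<le>) y z1"
    using z u by (intro exI[of _ "s @ x"] exI[of _ z] exI[of _ "u' @ v"]) simp
  moreover have "length ns = length ys"
    using ns(1) by (simp add: factors_embedding_def)
  ultimately show ?case
    using ns u len
    \<comment> \<open>The first factor starts after the prefix \<open>s\<close> and the gap
      \<open>x\<close>.\<close>
    by (intro exI[of _ "(length s + length x) # ns"])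
      (auto simp: factors_embedding_Cons factors_end_Cons add.assoc)
qed

text \<open>The two preceding lemmas for the prefix \<open>s = []\<close>, whose length is the
  default 0 in \<open>embedding_end\<close>.\<close>

lemma ex_embedding_end_iff:
  "(\<exists>ns. embedding p w ns \<and> embedding_end p ns = e) \<longleftrightarrow>
    (\<exists>u v. w = u @ v \<and> u \<in> ends_lang (factorization p) \<and> length u = e)"
proof
  assume "\<exists>ns. embedding p w ns \<and> embedding_end p ns = e"
  then show "\<exists>u v. w = u @ v \<and> u \<in> ends_lang (factorization p) \<and> length u = e"
    using ends_lang_if_factors_embedding[of "factorization p" "[]" w]
    by (fastforce simp: embedding_conv embedding_end_conv)
next
  assume "\<exists>u v. w = u @ v \<and> u \<in> ends_lang (factorization p) \<and> length u = e"
  then show "\<exists>ns. embedding p w ns \<and> embedding_end p ns = e"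
    using factors_embedding_if_ends_lang[of _ "factorization p" "[]"]
    by (fastforce simp: embedding_conv embedding_end_conv)
qed

section \<open>The languages of the pattern in terms of \<open>ends_lang\<close>\<close>

lemma pattern_F_conv: "pattern_F p = conc (ends_lang (factorization p)) UNIV"
proof -
  have "embeds p w \<longleftrightarrow> (\<exists>e ns. embedding p w ns \<and> embedding_end p ns = e)" for w
    unfolding embeds_def by blast
  then show ?thesis
    unfolding pattern_F_def conc_def ex_embedding_end_iff by blast
qed

lemma pattern_S_conv:
  "pattern_S p = pattern_F p \<inter> - conc (ends_lang (factorization p)) (- {[]})"
proof -
  \<comment> \<open>An embedding that violates the condition in \<open>pattern_S\<close> stops short
    of the end of \<open>w\<close>, leaving a nonempty rest after a prefix in
    \<open>ends_lang\<close>.\<close>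
  have "(\<exists>ns. embedding p w ns \<and> embedding_end p ns \<noteq> length w) \<longleftrightarrow>
      w \<in> conc (ends_lang (factorization p)) (- {[]})" for w
  proof -
    have "(\<exists>ns. embedding p w ns \<and> embedding_end p ns \<noteq> length w) \<longleftrightarrow>
        (\<exists>e. e \<noteq> length w \<and> (\<exists>ns. embedding p w ns \<and> embedding_end p ns = e))"
      by blast
    also have "\<dots> \<longleftrightarrow> (\<exists>u v. w = u @ v \<and> u \<in> ends_lang (factorization p) \<and> length u \<noteq> length w)"
      unfolding ex_embedding_end_iff by blast
    also have "\<dots> \<longleftrightarrow> (\<exists>u v. w = u @ v \<and> u \<in> ends_lang (factorization p) \<and> v \<noteq> [])"
      by (intro ex_cong1) auto
    finally show ?thesis
      by (simp add: conc_def)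
  qed
  then show ?thesis
    unfolding pattern_S_def by blast
qed

theorem theorem8p1:
  fixes p :: "'a::order pattern"
  assumes "wf_pattern p"
  shows "nfa_recognizable (pattern_F p) \<and> nfa_recognizable (pattern_S p) \<and>
    nfa_recognizable (pattern_A p)"
proof -
  let ?E = "ends_lang (factorization p)"
  have F: "finite_residuals (pattern_F p)"
    by (simp add: pattern_F_conv finite_residuals_conc finite_residuals_ends_lang
        finite_residuals_UNIV)
  have "finite_residuals (conc ?E (- {[]}))"
    by (intro finite_residuals_conc finite_residuals_Compl finite_residuals_ends_lang
        finite_residuals_singleton_Nil)
  then have S: "finite_residuals (pattern_S p)"
    unfolding pattern_S_conv by (intro finite_residuals_Int finite_residuals_Compl F)
  have A: "finite_residuals (pattern_A p)"
    using finite_residuals_Compl[OF F] by (simp add: pattern_A_def Compl_eq_Diff_UNIV)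
  show ?thesis
    using F S A by (simp add: nfa_recognizable_if_finite_residuals)
qed

end
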